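(* Let $n\ge1$ and let $\lambda=(\lambda_1\ge\cdots\ge\lambda_n\ge0)$ be a partition with at most $n$ nonzero parts. The map $\Omega:=\psi_{\mathrm{inv}}^{-1}\circ\psi_{\mathrm{quinv}}=\psi_{\mathrm{inv}}^{-1}\circ\mathrm{bcomp}\circ\psi_{\mathrm{inv}}:\mathrm{CSF}(\lambda)\to\mathrm{CSF}(\lambda)$ is an involution satisfying $\mathrm{inv}(\Omega(F))=\mathrm{quinv}(F)$ for all $F\in\mathrm{CSF}(\lambda)$.
   Context: $[n]=\{1,\dots,n\}$. The Young diagram $\mathrm{dg}(\lambda)$ is drawn in English convention (row $i$ from the top has $\lambda_i$ cells, left-justified). $\mathrm{CSF}(\lambda)$ is the set of column strict fillings: maps $F:\mathrm{dg}(\lambda)\to[n]$ whose values strictly increase going down each column (no condition on rows). $\mathrm{rsort}(F)$ sorts the entries of each row of $F$ in ascending order; for $F\in\mathrm{CSF}(\lambda)$ it is a semistandard Young tableau. $\mathrm{GT}(\lambda)$ is the set of integral Gelfand-Tsetlin patterns with bounding row $\lambda$: integer arrays $T=(T^j_i)_{1\le i\le j\le n}$ with $T^n_i=\lambda_i$ and $T^{j+1}_i\ge T^j_i\ge T^{j+1}_{i+1}$. $T$ is identified with the semistandard Young tableau of shape $\lambda$ with entries in $[n]$ for which $(T^j_1,\dots,T^j_j)$ is the shape formed by the cells with entries $\le j$. Put $\mathrm{NE}_{ij}(T)=T^{j+1}_i-T^j_i$ and $\mathrm{SE}_{ij}(T)=T^j_i-T^{j+1}_{i+1}$ for $1\le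 i\le j<n$. A partition overlaid pattern of shape $\lambda$ is a pair $(T,\Lambda)$ with $T\in\mathrm{GT}(\lambda)$ and $\Lambda=(\Lambda_{ij}:1\le i\le j<n)$ a tuple of partitions with $\Lambda_{ij}$ fitting in an $\mathrm{NE}_{ij}(T)\times\mathrm{SE}_{ij}(T)$ rectangle, where a partition fits in a $k\times\ell$ rectangle if it is of the form $\gamma_1\ge\cdots\ge\gamma_k\ge0$ with $\gamma_1\le\ell$. $\mathrm{POP}(\lambda)$ is the set of these. The complement of $\pi=(\pi_1\ge\cdots\ge\pi_k\ge0)$ in a $k\times\ell$ rectangle is $(\ell-\pi_k\ge\cdots\ge\ell-\pi_1)$; $\mathrm{bcomp}(T,\Lambda)=(T,\Lambda^c)$, where $(\Lambda^c)_{ij}$ is the complement of $\Lambda_{ij}$ in the $\mathrm{NE}_{ij}(T)\times\mathrm{SE}_{ij}(T)$ rectangle. Triples. For $F\in\mathrm{CSF}(\lambda)$ a quinv-triple (resp. refinv-triple) is a triple $(x,y,z)$ with $x,z\in\mathrm{dg}(\lambda)$ in the same row, $z$ to the right (resp. left) of $x$, $y$ the position immediately below $x$ in its column, and $F(x)<F(z)<F(y)$, where $F(y)=\infty$ if $y\notin\mathrm{dg}(\lambda)$. For a cell $c$, $\mathrm{zcount}(c,F)$ (resp. $\overline{\mathrm{zcount}}(c,F)$) is the number of quinv-triples (resp. refinv-triples) with $z=c$. $\mathrm{cells}(i,j,F)$ is the set of cells $c$ in row $i$ with $F(c)=j+1$. The maps $\psi_v$. For $F\in\mathrm{CSF}(\lambda)$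 let $T=\mathrm{rsort}(F)$ and, for $1\le i\le j<n$, let $\Lambda_{ij}$ be the sequence of $\mathrm{zcount}(c,F)$ for $c\in\mathrm{cells}(i,j,F)$ traversed right to left, and $\overline\Lambda_{ij}$ the sequence of $\overline{\mathrm{zcount}}(c,F)$ for $c\in\mathrm{cells}(i,j,F)$ traversed left to right. Then $\psi_{\mathrm{quinv}}(F)=(T,(\Lambda_{ij}))$ and $\psi_{\mathrm{inv}}(F)=(T,(\overline\Lambda_{ij}))$. Both are well-defined bijections $\mathrm{CSF}(\lambda)\to\mathrm{POP}(\lambda)$. Statistics. $\mathrm{quinv}(F)$ is the number of quinv-triples of $F$. $\mathrm{inv}(F)$ is the Haglund-Haiman-Loehr statistic, in English convention: two cells attack each other if they are in the same row, or are in rows $i$ and $i+1$ with the cell in row $i+1$ in a column strictly to the right of that of the cell in row $i$. The reading order goes through the rows from the lowest row to the top row, left to right in each row. $\mathrm{Inv}(F)$ is the set of pairs of attacking cells $\{u,w\}$ with $u$ preceding $w$ in reading order and $F(u)>F(w)$. $\mathrm{Des}(F)$ is the set of cells $u$ not in the top row with $F(u)$ greater than the entry of the cell immediately above $u$. $\mathrm{arm}(u)$ is the number of cells strictly to the right of $u$ in its row. Then $\mathrm{inv}(F)=|\mathrm{Inv}(F)|-\sum_{u\in\mathrm{Des}(F)}\mathrm{arm}(u)$. *)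

theory Defs
  imports "HOL-Library.FuncSet" "HOL-Library.Extended_Nat"
begin

section \<open>Partitions, diagrams and fillings\<close>

text \<open>
  The parts of a partition with at most \<open>n\<close> nonzero parts are \<open>lam 1, ..., lam n\<close>; the values of
  \<open>lam\<close> outside \<open>{1..n}\<close> are never used. A cell is a pair (row, column), both counted from 1,
  rows from the top. All functions with a finite index set (fillings, patterns, overlays) are
  extensional, so that the sets of such functions have the intended elements and no duplicates.
\<close>

definition is_partition :: "nat \<Rightarrow> (nat \<Rightarrow> nat) \<Rightarrow> bool" where
  "is_partition n lam \<longleftrightarrow> (\<forall>i j. 1 \<le> i \<and> i \<le> j \<and> j \<le> n \<longrightarrow> lam j \<le> lam i)"

type_synonym cell = "nat \<times> nat"
type_synonym filling = "cell \<Rightarrow> nat"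

definition dg :: "nat \<Rightarrow> (nat \<Rightarrow> nat) \<Rightarrow> cell set" where
  "dg n lam = {(r, c). 1 \<le> r \<and> r \<le> n \<and> 1 \<le> c \<and> c \<le> lam r}"

definition below :: "cell \<Rightarrow> cell" where
  "below u = (Suc (fst u), snd u)"

definition CSF :: "nat \<Rightarrow> (nat \<Rightarrow> nat) \<Rightarrow> filling set" where
  "CSF n lam = {F \<in> dg n lam \<rightarrow>\<^sub>E {1..n}.
     \<forall>u. u \<in> dg n lam \<and> below u \<in> dg n lam \<longrightarrow> F u < F (below u)}"

definition rsort :: "nat \<Rightarrow> (nat \<Rightarrow> nat) \<Rightarrow> filling \<Rightarrow> filling" where
  "rsort n lam F = restrict
     (\<lambda>(r, c). sort (map (\<lambda>k. F (r, k)) [1..<Suc (lam r)]) ! (c - 1)) (dg n lam)"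

section \<open>Gelfand-Tsetlin patterns and partition overlays\<close>

text \<open>
  A pattern is indexed by \<open>(i, j)\<close> with \<open>1 \<le> i \<le> j \<le> n\<close>; \<open>T (i, j)\<close> is the \<open>i\<close>-th entry of the
  row \<open>j\<close>, usually written with \<open>j\<close> as superscript and \<open>i\<close> as subscript. The interlacing
  inequalities bound every entry from below by some \<open>lam k \<ge> 0\<close>, so integer patterns are patterns
  of natural numbers, and the subtractions in \<open>NE\<close> and \<open>SE\<close> do not truncate on patterns.
\<close>

type_synonym pattern = "nat \<times> nat \<Rightarrow> nat"

definition GT :: "nat \<Rightarrow> (nat \<Rightarrow> nat) \<Rightarrow> pattern set" where
  "GT n lam = {T \<in> extensional {(i, j). 1 \<le> i \<and> i \<le> j \<and> j \<le> n}.
     (\<forall>i. 1 \<le> i \<and> i \<le> n \<longrightarrow> T (i, n) = lam i) \<and>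
     (\<forall>i j. 1 \<le> i \<and> i \<le> j \<and> j < n \<longrightarrow> T (i, j) \<le> T (i, j + 1) \<and> T (i + 1, j + 1) \<le> T (i, j))}"

text \<open>
  The pattern identified with a tableau \<open>S\<close>: row \<open>j\<close> is the shape formed by the entries \<open>\<le> j\<close>.
\<close>

definition pattern_of :: "nat \<Rightarrow> (nat \<Rightarrow> nat) \<Rightarrow> filling \<Rightarrow> pattern" where
  "pattern_of n lam S = restrict
     (\<lambda>(i, j). card {u \<in> dg n lam. fst u = i \<and> S u \<le> j}) {(i, j). 1 \<le> i \<and> i \<le> j \<and> j \<le> n}"

definition NE :: "pattern \<Rightarrow> nat \<Rightarrow> nat \<Rightarrow> nat" where
  "NE T i j = T (i, j + 1) - T (i, j)"

definition SE :: "pattern \<Rightarrow> nat \<Rightarrow> nat \<Rightarrow> nat" where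
  "SE T i j = T (i, j) - T (i + 1, j + 1)"

text \<open>
  A partition in a \<open>k \<times> l\<close> rectangle is represented by the list of exactly \<open>k\<close> parts,
  trailing zeros included.
\<close>

definition fits :: "nat \<Rightarrow> nat \<Rightarrow> nat list \<Rightarrow> bool" where
  "fits k l p \<longleftrightarrow> length p = k \<and> sorted_wrt (\<ge>) p \<and> (\<forall>x \<in> set p. x \<le> l)"

definition complement :: "nat \<Rightarrow> nat list \<Rightarrow> nat list" where
  "complement l p = map (\<lambda>x. l - x) (rev p)"

type_synonym overlay = "nat \<times> nat \<Rightarrow> nat list"

definition overlay_idx :: "nat \<Rightarrow> (nat \<times> nat) set" where
  "overlay_idx n = {(i, j). 1 \<le> i \<and> i \<le> j \<and> j < n}"

definition POP :: "nat \<Rightarrow> (nat \<Rightarrow> nat) \<Rightarrow> (pattern \<times> overlay) set" where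
  "POP n lam = {(T, L). T \<in> GT n lam \<and> L \<in> extensional (overlay_idx n) \<and>
     (\<forall>(i, j) \<in> overlay_idx n. fits (NE T i j) (SE T i j) (L (i, j)))}"

definition bcomp :: "nat \<Rightarrow> pattern \<times> overlay \<Rightarrow> pattern \<times> overlay" where
  "bcomp n = (\<lambda>(T, L). (T, restrict (\<lambda>(i, j). complement (SE T i j) (L (i, j))) (overlay_idx n)))"

section \<open>Triples and the two bijections\<close>

definition entry :: "nat \<Rightarrow> (nat \<Rightarrow> nat) \<Rightarrow> filling \<Rightarrow> cell \<Rightarrow> enat" where
  "entry n lam F u = (if u \<in> dg n lam then enat (F u) else \<infinity>)"

definition quinv_triples :: "nat \<Rightarrow> (nat \<Rightarrow> nat) \<Rightarrow> filling \<Rightarrow> (cell \<times> cell \<times> cell) set" where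
  "quinv_triples n lam F = {(x, y, z). x \<in> dg n lam \<and> z \<in> dg n lam \<and>
     fst z = fst x \<and> snd x < snd z \<and> y = below x \<and>
     entry n lam F x < entry n lam F z \<and> entry n lam F z < entry n lam F y}"

definition refinv_triples :: "nat \<Rightarrow> (nat \<Rightarrow> nat) \<Rightarrow> filling \<Rightarrow> (cell \<times> cell \<times> cell) set" where
  "refinv_triples n lam F = {(x, y, z). x \<in> dg n lam \<and> z \<in> dg n lam \<and>
     fst z = fst x \<and> snd z < snd x \<and> y = below x \<and>
     entry n lam F x < entry n lam F z \<and> entry n lam F z < entry n lam F y}"

definition zcount :: "nat \<Rightarrow> (nat \<Rightarrow> nat) \<Rightarrow> filling \<Rightarrow> cell \<Rightarrow> nat" where
  "zcount n lam F c = card {(x, y, z) \<in> quinv_triples n lam F. z = c}"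

definition refzcount :: "nat \<Rightarrow> (nat \<Rightarrow> nat) \<Rightarrow> filling \<Rightarrow> cell \<Rightarrow> nat" where
  "refzcount n lam F c = card {(x, y, z) \<in> refinv_triples n lam F. z = c}"

definition cells :: "nat \<Rightarrow> (nat \<Rightarrow> nat) \<Rightarrow> nat \<Rightarrow> nat \<Rightarrow> filling \<Rightarrow> cell set" where
  "cells n lam i j F = {c \<in> dg n lam. fst c = i \<and> F c = j + 1}"

definition cells_ltr :: "nat \<Rightarrow> (nat \<Rightarrow> nat) \<Rightarrow> nat \<Rightarrow> nat \<Rightarrow> filling \<Rightarrow> cell list" where
  "cells_ltr n lam i j F = map (Pair i) (sorted_list_of_set (snd ` cells n lam i j F))"

definition psi_quinv :: "nat \<Rightarrow> (nat \<Rightarrow> nat) \<Rightarrow> filling \<Rightarrow> pattern \<times> overlay" where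
  "psi_quinv n lam F = (pattern_of n lam (rsort n lam F),
     restrict (\<lambda>(i, j). map (zcount n lam F) (rev (cells_ltr n lam i j F))) (overlay_idx n))"

definition psi_inv :: "nat \<Rightarrow> (nat \<Rightarrow> nat) \<Rightarrow> filling \<Rightarrow> pattern \<times> overlay" where
  "psi_inv n lam F = (pattern_of n lam (rsort n lam F),
     restrict (\<lambda>(i, j). map (refzcount n lam F) (cells_ltr n lam i j F)) (overlay_idx n))"

definition Omega :: "nat \<Rightarrow> (nat \<Rightarrow> nat) \<Rightarrow> filling \<Rightarrow> filling" where
  "Omega n lam F = inv_into (CSF n lam) (psi_inv n lam) (psi_quinv n lam F)"

section \<open>Statistics\<close>

definition quinv :: "nat \<Rightarrow> (nat \<Rightarrow> nat) \<Rightarrow> filling \<Rightarrow> nat" where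
  "quinv n lam F = card (quinv_triples n lam F)"

definition attack :: "cell \<Rightarrow> cell \<Rightarrow> bool" where
  "attack u w \<longleftrightarrow> (u \<noteq> w \<and> fst u = fst w) \<or>
     (fst w = Suc (fst u) \<and> snd u < snd w) \<or> (fst u = Suc (fst w) \<and> snd w < snd u)"

definition precedes :: "cell \<Rightarrow> cell \<Rightarrow> bool" where
  "precedes u w \<longleftrightarrow> fst w < fst u \<or> (fst u = fst w \<and> snd u < snd w)"

text \<open>
  Each pair of attacking cells is listed once, as the ordered pair in reading order.
\<close>

definition Inv_pairs :: "nat \<Rightarrow> (nat \<Rightarrow> nat) \<Rightarrow> filling \<Rightarrow> (cell \<times> cell) set" where
  "Inv_pairs n lam F = {(u, w). u \<in> dg n lam \<and> w \<in> dg n lam \<and>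
     attack u w \<and> precedes u w \<and> F w < F u}"

definition Des :: "nat \<Rightarrow> (nat \<Rightarrow> nat) \<Rightarrow> filling \<Rightarrow> cell set" where
  "Des n lam F = {u \<in> dg n lam. 1 < fst u \<and> F (fst u - 1, snd u) < F u}"

definition arm :: "nat \<Rightarrow> (nat \<Rightarrow> nat) \<Rightarrow> cell \<Rightarrow> nat" where
  "arm n lam u = card {w \<in> dg n lam. fst w = fst u \<and> snd u < snd w}"

definition inv_stat :: "nat \<Rightarrow> (nat \<Rightarrow> nat) \<Rightarrow> filling \<Rightarrow> int" where
  "inv_stat n lam F = int (card (Inv_pairs n lam F)) - (\<Sum>u \<in> Des n lam F. int (arm n lam u))"

end

theory Submission
  imports Defs
begin

text \<open>
  Let \<open>S i j\<close> be the set of columns of the row \<open>i\<close> whose entry is \<open>\<le> j\<close>. A filling is column strict iff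
  \<open>S (i+1) (j+1) \<subseteq> S i j \<subseteq> S i (j+1)\<close>, so the sets \<open>S i j\<close> form a set-valued Gelfand-Tsetlin pattern.
  The cells counted by \<open>refzcount\<close> for an entry \<open>j+1\<close> of the row \<open>i\<close> are those of \<open>S i j - S (i+1) (j+1)\<close>
  to its right. Hence, inside \<open>W = S i (j+1) - S (i+1) (j+1)\<close>, the partition \<open>(i, j)\<close> of \<open>psi_inv\<close> encodes
  the subset \<open>S i (j+1) - S i j\<close> by its usual lattice path, and the sets \<open>S i j\<close> are recovered from
  the overlay by descending recursion on \<open>j\<close>. Since \<open>zcount\<close> counts the same columns to the left, it is
  complementary to \<open>refzcount\<close>.

  Finally, every cell below the top row is a descent, so the arms cancel against the pairs in consecutive
  rows, and what remains of \<open>inv_stat\<close> is the number of refinv-triples.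
\<close>

section \<open>Subsets of a finite set as partitions in a box\<close>

text \<open>Reading \<open>W\<close> from left to right as a lattice path, with vertical steps at
  \<open>Z\<close> and horizontal ones elsewhere, gives these parts as row lengths. Zero parts are
  kept, so the length records \<open>card Z\<close>.\<close>

definition code :: "nat set \<Rightarrow> nat set \<Rightarrow> nat list" where
  "code W Z = map (\<lambda>z. card {x \<in> W - Z. z < x}) (sorted_list_of_set Z)"

lemma length_code [simp]: "length (code W Z) = card Z"
  by (simp add: code_def)

lemma code_bound: "finite W \<Longrightarrow> x \<in> set (code W Z) \<Longrightarrow> x \<le> card (W - Z)"
  by (auto simp: code_def intro!: card_mono)

lemma sorted_code:
  assumes "finite W"
  shows "sorted_wrt (\<ge>) (code W Z)"
proof -
  have "card {x \<in> W - Z. b < x} \<le> card {x \<in> W - Z. a < x}" if "a \<le> b" for a b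
    using assms that by (intro card_mono) auto
  then have "sorted_wrt (\<lambda>a b. card {x \<in> W - Z. b < x} \<le> card {x \<in> W - Z. a < x}) (sorted_list_of_set Z)"
    by (intro sorted_wrt_mono_rel[OF _ sorted_sorted_list_of_set]) auto
  then show ?thesis
    by (simp add: code_def sorted_wrt_map)
qed

lemma fits_code:
  assumes "finite W" "Z \<subseteq> W"
  shows "fits (card Z) (card (W - Z)) (code W Z)"
  using assms sorted_code code_bound by (simp add: fits_def)

lemma sorted_list_of_set_insert_max:
  assumes "finite Z" "\<And>z. z \<in> Z \<Longrightarrow> z < (m::nat)"
  shows "sorted_list_of_set (insert m Z) = sorted_list_of_set Z @ [m]"
proof (rule sorted_distinct_set_unique)
  show "sorted (sorted_list_of_set Z @ [m])"
    using assms by (auto simp: sorted_append less_imp_le)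
  show "set (sorted_list_of_set (insert m Z)) = set (sorted_list_of_set Z @ [m])"
    using assms(1) by (simp only: set_sorted_list_of_set set_append finite_insert) simp
qed (use assms in \<open>auto simp del: sorted_list_of_set_insert_remove\<close>)

text \<open>A new maximum in \<open>Z\<close> has nothing to its right and is never counted by the
  others: it only adds a final zero.\<close>

lemma code_insert_max:
  assumes "finite W" "\<And>x. x \<in> W \<Longrightarrow> x < m" "Z \<subseteq> W"
  shows "code (insert m W) (insert m Z) = code W Z @ [0]"
proof -
  have fin: "finite Z"
    using assms finite_subset by blast
  have eq: "insert m W - insert m Z = W - Z"
    using assms by auto
  have "{x \<in> W - Z. m < x} = {}"
    using assms(2) by fastforce
  then have "card {x \<in> W - Z. m < x} = 0"
    by (simp only: card.empty)
  moreover have "sorted_list_of_set (insert m Z) = sorted_list_of_set Z @ [m]"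
    using fin assms by (intro sorted_list_of_set_insert_max) auto
  ultimately show ?thesis
    by (simp only: code_def eq) simp
qed

text \<open>A new maximum outside \<open>Z\<close> lies to the right of every element of
  \<open>Z\<close>, so each part grows by one.\<close>

lemma code_skip_max:
  assumes "finite W" "\<And>x. x \<in> W \<Longrightarrow> x < m" "Z \<subseteq> W"
  shows "code (insert m W) Z = map Suc (code W Z)"
proof -
  have fin: "finite Z"
    using assms finite_subset by blast
  have "card {x \<in> insert m W - Z. z < x} = Suc (card {x \<in> W - Z. z < x})" if "z \<in> Z" for z
  proof -
    have "{x \<in> insert m W - Z. z < x} = insert m {x \<in> W - Z. z < x}"
      using assms that by auto
    moreover have "m \<notin> W" using assms(2) by blast
    ultimately show ?thesis
      using assms(1) by simp
  qed
  then show ?thesis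
    using fin by (simp add: code_def)
qed

text \<open>Induction on \<open>W\<close> by removing its maximum \<open>m\<close>: by the two
  preceding lemmas, \<open>m\<close> lies in \<open>Z\<close> exactly when the last part of
  \<open>p\<close> is zero. An empty \<open>p\<close> forces \<open>Z\<close> to be empty.\<close>

lemma code_ex1:
  assumes "finite W" "length p \<le> card W" "fits (length p) (card W - length p) p"
  shows "\<exists>!Z. Z \<subseteq> W \<and> code W Z = p"
  using assms
proof (induction W arbitrary: p rule: finite_linorder_max_induct)
  case empty
  then show ?case by (auto simp: code_def)
next
  case (insert m W)
  have mW: "m \<notin> W" using insert.hyps by blast
  note card_ins = card_insert_disjoint[OF insert.hyps(1) mW]
  consider "p = []" | q where "p = q @ [0]" | q a where "p = q @ [Suc a]"
    by (metis rev_exhaust not0_implies_Suc)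
  then show ?case
  proof cases
    case 1
    have "Z = {}" if "Z \<subseteq> insert m W" "code (insert m W) Z = []" for Z
    proof -
      have "card Z = 0" using that(2) length_code[of "insert m W" Z] by simp
      moreover have "finite Z" using that(1) insert.hyps(1) finite_subset by blast
      ultimately show ?thesis by simp
    qed
    then show ?thesis
      unfolding 1 by (intro ex1I[of _ "{}"]) (auto simp: code_def)
  next
    case 2
    have "fits (length q) (card W - length q) q" "length q \<le> card W"
      using insert.prems card_ins by (auto simp: 2 fits_def sorted_wrt_append)
    from insert.IH[OF this(2,1)] obtain Z0 where Z0: "Z0 \<subseteq> W" "code W Z0 = q"
      and uniq: "\<And>Z. Z \<subseteq> W \<Longrightarrow> code W Z = q \<Longrightarrow> Z = Z0" by metis
    show ?thesis
    proof (rule ex1I[of _ "insert m Z0"])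
      show "insert m Z0 \<subseteq> insert m W \<and> code (insert m W) (insert m Z0) = p"
        using Z0 insert.hyps by (auto simp: code_insert_max 2)
    next
      fix Z assume Z: "Z \<subseteq> insert m W \<and> code (insert m W) Z = p"
      have "m \<in> Z"
      proof (rule ccontr)
        assume "m \<notin> Z"
        then have "map Suc (code W Z) = q @ [0]"
          using Z insert.hyps code_skip_max[of W m Z] by (simp add: 2 subset_insert)
        then show False by (auto simp: map_eq_append_conv)
      qed
      then obtain Z' where Z': "Z = insert m Z'" "m \<notin> Z'" by (meson Set.set_insert)
      then have "Z' \<subseteq> W" using Z by auto
      moreover have "code W Z' = q"
        using Z insert.hyps \<open>Z' \<subseteq> W\<close> by (simp add: Z' code_insert_max 2)
      ultimately show "Z = insert m Z0" using uniq Z' by simp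
    qed
  next
    case 3
    have pos: "\<forall>x \<in> set p. 0 < x"
      using insert.prems(2) by (fastforce simp: 3 fits_def sorted_wrt_append)
    define r where "r = map (\<lambda>x. x - 1) p"
    have p: "p = map Suc r"
      using pos by (simp add: r_def o_def map_idI)
    \<comment> \<open>The last part is positive and at most the width of the box, so the width is
      positive and can be lowered by one along with all parts.\<close>
    have "length p < card (insert m W)"
      using insert.prems(2) by (auto simp: 3 fits_def)
    then have "fits (length r) (card W - length r) r" "length r \<le> card W"
      using insert.prems card_ins by (auto simp: p fits_def sorted_wrt_map)
    from insert.IH[OF this(2,1)] obtain Z0 where Z0: "Z0 \<subseteq> W" "code W Z0 = r"
      and uniq: "\<And>Z. Z \<subseteq> W \<Longrightarrow> code W Z = r \<Longrightarrow> Z = Z0" by metis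
    show ?thesis
    proof (rule ex1I[of _ Z0])
      show "Z0 \<subseteq> insert m W \<and> code (insert m W) Z0 = p"
        using Z0 insert.hyps by (auto simp: code_skip_max p)
    next
      fix Z assume Z: "Z \<subseteq> insert m W \<and> code (insert m W) Z = p"
      have "m \<notin> Z"
      proof
        assume "m \<in> Z"
        then obtain Z' where Z': "Z = insert m Z'" "m \<notin> Z'" by (meson Set.set_insert)
        then have "Z' \<subseteq> W" using Z by auto
        then have "p = code W Z' @ [0]"
          using Z insert.hyps by (simp add: Z' code_insert_max)
        then show False using pos by simp
      qed
      then have "Z \<subseteq> W" using Z by auto
      moreover have "code W Z = r"
      proof -
        have "map Suc (code W Z) = map Suc r"
          using Z insert.hyps code_skip_max[of W m Z] \<open>Z \<subseteq> W\<close> by (simp add: p)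
        then show ?thesis by simp
      qed
      ultimately show "Z = Z0" using uniq by simp
    qed
  qed
qed

section \<open>Level sets of the rows of a filling\<close>

definition level :: "nat \<Rightarrow> (nat \<Rightarrow> nat) \<Rightarrow> filling \<Rightarrow> nat \<Rightarrow> nat \<Rightarrow> nat set" where
  "level n lam F i j = {c. (i, c) \<in> dg n lam \<and> F (i, c) \<le> j}"

lemma finite_dg [simp]: "finite (dg n lam)"
proof -
  have "dg n lam \<subseteq> (SIGMA r:{1..n}. {1..lam r})"
    by (auto simp: dg_def)
  then show ?thesis by (rule finite_subset) simp
qed

lemma finite_level [simp]: "finite (level n lam F i j)"
  by (rule finite_subset[of _ "{..lam i}"]) (auto simp: level_def dg_def)

section \<open>Row sorting and triple counts in terms of level sets\<close>

lemma card_filter_nth: "card {c. 1 \<le> c \<and> c \<le> length xs \<and> P (xs ! (c - 1))} = length (filter P xs)"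
proof -
  have "{c. 1 \<le> c \<and> c \<le> length xs \<and> P (xs ! (c - 1))} = Suc ` {k. k < length xs \<and> P (xs ! k)}"
  proof safe
    fix c assume "1 \<le> c" "c \<le> length xs" "P (xs ! (c - 1))"
    then show "c \<in> Suc ` {k. k < length xs \<and> P (xs ! k)}"
      by (intro image_eqI[of _ _ "c - 1"]) auto
  qed auto
  then show ?thesis
    by (simp add: card_image length_filter_conv_card)
qed

text \<open>Sorting permutes the entries of a row, so the number of those up to \<open>j\<close>
  does not change. From here on patterns can be handled without \<open>rsort\<close>.\<close>

lemma pattern_of_rsort:
  assumes "1 \<le> i" "i \<le> j" "j \<le> n"
  shows "pattern_of n lam (rsort n lam F) (i, j) = card (level n lam F i j)"
proof -
  define xs where "xs = map (\<lambda>k. F (i, k)) [1..<Suc (lam i)]"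
  have len: "length xs = lam i" by (simp add: xs_def del: upt_Suc)
  have nth: "xs ! (c - 1) = F (i, c)" if "1 \<le> c" "c \<le> lam i" for c
  proof -
    have "c - 1 < lam i" using that by simp
    then show ?thesis using that by (simp add: xs_def del: upt_Suc)
  qed
  have rs: "rsort n lam F (i, c) = sort xs ! (c - 1)" if "(i, c) \<in> dg n lam" for c
    using that by (simp add: rsort_def xs_def del: upt_Suc)
  have "{u \<in> dg n lam. fst u = i \<and> rsort n lam F u \<le> j}
      = Pair i ` {c. 1 \<le> c \<and> c \<le> length (sort xs) \<and> sort xs ! (c - 1) \<le> j}"
    using assms rs by (auto simp: dg_def len image_iff)
  then have "pattern_of n lam (rsort n lam F) (i, j)
      = card {c. 1 \<le> c \<and> c \<le> length (sort xs) \<and> sort xs ! (c - 1) \<le> j}"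
    using assms by (simp add: pattern_of_def card_image inj_on_def)
  also have "\<dots> = length (filter (\<lambda>x. x \<le> j) (sort xs))"
    by (rule card_filter_nth)
  also have "\<dots> = length (filter (\<lambda>x. x \<le> j) xs)"
    by (simp add: filter_sort)
  also have "\<dots> = card {c. 1 \<le> c \<and> c \<le> length xs \<and> xs ! (c - 1) \<le> j}"
    by (rule card_filter_nth[symmetric])
  also have "{c. 1 \<le> c \<and> c \<le> length xs \<and> xs ! (c - 1) \<le> j} = level n lam F i j"
    using assms nth by (auto simp: level_def dg_def len)
  finally show ?thesis .
qed

text \<open>With \<open>z\<close> fixed, a triple is determined by the column \<open>d\<close> of
  \<open>x\<close>. The condition on \<open>y\<close> fails only if \<open>y\<close> is in the
  diagram with an entry up to that of \<open>z\<close>; hence nonmembership in a level set covers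
  the value infinity as well.\<close>

lemma zcount_eq:
  assumes "(i, z) \<in> dg n lam"
  shows "zcount n lam F (i, z)
    = card {d. (i, d) \<in> dg n lam \<and> d < z \<and> F (i, d) < F (i, z) \<and> d \<notin> level n lam F (Suc i) (F (i, z))}"
    (is "_ = card ?D")
proof -
  have "{(x, y, z') \<in> quinv_triples n lam F. z' = (i, z)} = (\<lambda>d. ((i, d), (Suc i, d), (i, z))) ` ?D"
    using assms by (auto simp: quinv_triples_def entry_def below_def level_def image_iff split: if_splits)
  then show ?thesis
    by (simp add: zcount_def card_image inj_on_def)
qed

lemma refzcount_eq:
  assumes "(i, z) \<in> dg n lam"
  shows "refzcount n lam F (i, z)
    = card {d. (i, d) \<in> dg n lam \<and> z < d \<and> F (i, d) < F (i, z) \<and> d \<notin> level n lam F (Suc i) (F (i, z))}"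
    (is "_ = card ?D")
proof -
  have "{(x, y, z') \<in> refinv_triples n lam F. z' = (i, z)} = (\<lambda>d. ((i, d), (Suc i, d), (i, z))) ` ?D"
    using assms by (auto simp: refinv_triples_def entry_def below_def level_def image_iff split: if_splits)
  then show ?thesis
    by (simp add: refzcount_def card_image inj_on_def)
qed

lemma snd_cells: "snd ` cells n lam i j F = level n lam F i (Suc j) - level n lam F i j"
  by (auto simp: cells_def level_def image_iff)

lemma set_cells_ltr [simp]: "set (cells_ltr n lam i j F) = cells n lam i j F"
  by (auto simp: cells_ltr_def snd_cells cells_def level_def image_iff)

lemma distinct_cells_ltr [simp]: "distinct (cells_ltr n lam i j F)"
  by (simp add: cells_ltr_def distinct_map inj_on_def)

lemma CSF_range:
  assumes "F \<in> CSF n lam" "u \<in> dg n lam"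
  shows "1 \<le> F u" "F u \<le> n"
  using assms PiE_mem[of F "dg n lam" "\<lambda>_. {1..n}" u] by (auto simp: CSF_def)

lemma level_top:
  assumes "F \<in> CSF n lam" "1 \<le> i" "i \<le> n"
  shows "level n lam F i n = {1..lam i}"
proof -
  have "F (i, c) \<le> n" if "(i, c) \<in> dg n lam" for c
    using CSF_range[OF assms(1) that] by simp
  then show ?thesis using assms(2,3) by (auto simp: level_def dg_def)
qed

lemma level_mono: "j \<le> k \<Longrightarrow> level n lam F i j \<subseteq> level n lam F i k"
  by (auto simp: level_def)

section \<open>Column strict fillings: interlacing level sets and injectivity of
  \<open>psi_inv\<close>\<close>

context
  fixes n :: nat and lam :: "nat \<Rightarrow> nat"
  assumes part: "is_partition n lam"
begin

lemma dg_up: "(Suc i, c) \<in> dg n lam \<Longrightarrow> 1 \<le> i \<Longrightarrow> (i, c) \<in> dg n lam"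
  using part[unfolded is_partition_def, rule_format, of i "Suc i"] by (auto simp: dg_def)

lemma CSF_less:
  assumes "F \<in> CSF n lam" "(Suc i, c) \<in> dg n lam" "1 \<le> i"
  shows "F (i, c) < F (Suc i, c)"
  using assms dg_up[of i c] by (force simp: CSF_def below_def)

lemma CSF_ge_row:
  assumes F: "F \<in> CSF n lam" and "(i, c) \<in> dg n lam"
  shows "i \<le> F (i, c)"
  using assms(2)
proof (induction i)
  case (Suc i)
  show ?case
  proof (cases "1 \<le> i")
    case True
    then show ?thesis
      using Suc.IH[OF dg_up[OF Suc.prems]] CSF_less[OF F Suc.prems] by simp
  next
    case False
    then show ?thesis using CSF_range(1)[OF F Suc.prems] by simp
  qed
qed simp

lemma level_empty: "F \<in> CSF n lam \<Longrightarrow> j < i \<Longrightarrow> level n lam F i j = {}"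
  by (auto simp: level_def dest!: CSF_ge_row)

lemma level_interlace:
  assumes F: "F \<in> CSF n lam" and "1 \<le> i"
  shows "level n lam F (Suc i) (Suc j) \<subseteq> level n lam F i j"
proof
  fix c assume "c \<in> level n lam F (Suc i) (Suc j)"
  then have c: "(Suc i, c) \<in> dg n lam" "F (Suc i, c) \<le> Suc j"
    by (auto simp: level_def)
  then show "c \<in> level n lam F i j"
    using CSF_less[OF F c(1) \<open>1 \<le> i\<close>] dg_up[OF c(1) \<open>1 \<le> i\<close>] by (simp add: level_def)
qed

text \<open>The cells with entry \<open>j + 1\<close> occupy the second argument of
  \<open>code\<close>. Its complement in the first consists of the columns with entry up to
  \<open>j\<close> in row \<open>i\<close> that are not in the level set below, which are the
  columns counted in \<open>refzcount_eq\<close>.\<close>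

lemma overlay_code:
  assumes F: "F \<in> CSF n lam" and "1 \<le> i"
  shows "map (refzcount n lam F) (cells_ltr n lam i j F)
    = code (level n lam F i (Suc j) - level n lam F (Suc i) (Suc j))
        (level n lam F i (Suc j) - level n lam F i j)"
proof -
  let ?Z = "level n lam F i (Suc j) - level n lam F i j"
  let ?W = "level n lam F i (Suc j) - level n lam F (Suc i) (Suc j)"
  have "refzcount n lam F (i, z) = card {x \<in> ?W - ?Z. z < x}" if "z \<in> ?Z" for z
  proof -
    have z: "(i, z) \<in> dg n lam" "F (i, z) = Suc j"
      using that by (auto simp: level_def)
    show ?thesis
      unfolding refzcount_eq[OF z(1)] z(2)
      by (rule arg_cong[of _ _ card]) (auto simp: level_def)
  qed
  then show ?thesis
    by (simp add: cells_ltr_def code_def snd_cells)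
qed

lemma NE_pattern:
  assumes "1 \<le> i" "i \<le> j" "j < n"
  shows "NE (pattern_of n lam (rsort n lam F)) i j = card (level n lam F i (Suc j) - level n lam F i j)"
  using assms by (simp add: NE_def pattern_of_rsort card_Diff_subset level_mono)

lemma SE_pattern:
  assumes "F \<in> CSF n lam" "1 \<le> i" "i \<le> j" "j < n"
  shows "SE (pattern_of n lam (rsort n lam F)) i j = card (level n lam F i j - level n lam F (Suc i) (Suc j))"
  using assms by (simp add: SE_def pattern_of_rsort card_Diff_subset level_interlace)

lemma pattern_of_rsort_GT:
  assumes F: "F \<in> CSF n lam"
  shows "pattern_of n lam (rsort n lam F) \<in> GT n lam"
proof -
  have "pattern_of n lam (rsort n lam F) \<in> extensional {(i, j). 1 \<le> i \<and> i \<le> j \<and> j \<le> n}"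
    by (simp add: pattern_of_def)
  then show ?thesis
    using level_top[OF F]
    by (auto simp: GT_def pattern_of_rsort intro!: card_mono level_mono level_interlace[OF F])
qed

lemma psi_inv_POP:
  assumes F: "F \<in> CSF n lam"
  shows "psi_inv n lam F \<in> POP n lam"
proof -
  have "fits (NE (pattern_of n lam (rsort n lam F)) i j) (SE (pattern_of n lam (rsort n lam F)) i j)
     (map (refzcount n lam F) (cells_ltr n lam i j F))" if "(i, j) \<in> overlay_idx n" for i j
  proof -
    have ij: "1 \<le> i" "i \<le> j" "j < n" using that by (auto simp: overlay_idx_def)
    let ?A = "level n lam F i (Suc j)" and ?S = "level n lam F i j" and ?B = "level n lam F (Suc i) (Suc j)"
    have "?B \<subseteq> ?S" "?S \<subseteq> ?A"
      using level_interlace[OF F ij(1)] by (auto intro: level_mono[THEN subsetD, rotated])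
    then have "?A - ?S \<subseteq> ?A - ?B" "(?A - ?B) - (?A - ?S) = ?S - ?B" by auto
    then show ?thesis
      using fits_code[of "?A - ?B" "?A - ?S"] ij F
      by (simp add: overlay_code NE_pattern SE_pattern)
  qed
  then show ?thesis
    using pattern_of_rsort_GT[OF F] by (auto simp: POP_def psi_inv_def)
qed

lemma CSF_eqI:
  assumes F: "F \<in> CSF n lam" and G: "G \<in> CSF n lam"
    and eq: "\<And>i j. 1 \<le> i \<Longrightarrow> i \<le> n \<Longrightarrow> j \<le> n \<Longrightarrow> level n lam F i j = level n lam G i j"
  shows "F = G"
proof (rule PiE_ext[of _ "dg n lam" "\<lambda>_. {1..n}"])
  show "F \<in> dg n lam \<rightarrow>\<^sub>E {1..n}" "G \<in> dg n lam \<rightarrow>\<^sub>E {1..n}"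
    using F G by (auto simp: CSF_def)
  fix u assume u: "u \<in> dg n lam"
  obtain i c where ic: "u = (i, c)" by (cases u)
  have i: "1 \<le> i" "i \<le> n" using u by (auto simp: ic dg_def)
  have "F u \<le> n" "G u \<le> n" using u F G by (auto intro: CSF_range)
  then show "F u = G u"
    using u eq[OF i, of "F u"] eq[OF i, of "G u"] by (auto simp: ic level_def intro!: antisym)
qed

text \<open>Descending induction on \<open>j\<close>: level \<open>n\<close> is the whole row, and
  once level \<open>j + 1\<close> is known, the box set \<open>?A - ?B\<close> is known and the code
  determines which columns leave.\<close>

lemma psi_inv_inj: "inj_on (psi_inv n lam) (CSF n lam)"
proof (rule inj_onI)
  fix F G assume F: "F \<in> CSF n lam" and G: "G \<in> CSF n lam" and eq: "psi_inv n lam F = psi_inv n lam G"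
  have *: "\<forall>i. 1 \<le> i \<and> i \<le> n \<longrightarrow> level n lam F i j = level n lam G i j" if "j \<le> n" for j
    using that
  proof (induction j rule: inc_induct)
    case base
    then show ?case using level_top F G by simp
  next
    case (step j)
    show ?case
    proof (intro allI impI)
      fix i assume i: "1 \<le> i \<and> i \<le> n"
      show "level n lam F i j = level n lam G i j"
      proof (cases "i \<le> j")
        case False
        \<comment> \<open>Row \<open>i\<close> has no entries below \<open>i\<close>, so both sets
          are empty where the overlay has no component.\<close>
        then show ?thesis using F G by (simp add: level_empty)
      next
        case True
        let ?A = "level n lam F i (Suc j)" and ?B = "level n lam F (Suc i) (Suc j)"
        have A: "level n lam G i (Suc j) = ?A" and B: "level n lam G (Suc i) (Suc j) = ?B"
          using step i True by simp_all
        have idx: "(i, j) \<in> overlay_idx n" using i True step by (simp add: overlay_idx_def)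
        have "snd (psi_inv n lam F) (i, j) = snd (psi_inv n lam G) (i, j)" using eq by simp
        then have "code (?A - ?B) (?A - level n lam F i j) = code (?A - ?B) (?A - level n lam G i j)"
          using idx i overlay_code[OF F, of i j] overlay_code[OF G, of i j]
          by (simp add: psi_inv_def A B)
        moreover have sub: "level n lam F i j \<subseteq> ?A" "level n lam G i j \<subseteq> ?A"
          using A level_mono[of j "Suc j" n lam _ i] by auto
        moreover have "?A - level n lam F i j \<subseteq> ?A - ?B" "?A - level n lam G i j \<subseteq> ?A - ?B"
          using level_interlace[OF F, of i j] level_interlace[OF G, of i j] i B by auto
        moreover have "\<exists>!Z. Z \<subseteq> ?A - ?B \<and> code (?A - ?B) Z = code (?A - ?B) (?A - level n lam F i j)"
        proof (rule code_ex1)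
          have Z: "?A - level n lam F i j \<subseteq> ?A - ?B" by fact
          then show "length (code (?A - ?B) (?A - level n lam F i j)) \<le> card (?A - ?B)"
            by (simp add: card_mono)
          show "fits (length (code (?A - ?B) (?A - level n lam F i j)))
            (card (?A - ?B) - length (code (?A - ?B) (?A - level n lam F i j)))
            (code (?A - ?B) (?A - level n lam F i j))"
            using fits_code[OF _ Z] card_Diff_subset[OF _ Z] by simp
        qed simp
        ultimately have "?A - level n lam F i j = ?A - level n lam G i j" by metis
        then show ?thesis using sub by blast
      qed
    qed
  qed
  show "F = G" using * by (intro CSF_eqI F G) auto
qed

end

section \<open>Reconstruction of a filling from a partition overlaid pattern\<close>

text \<open>The inverse of \<open>code\<close> within \<open>W\<close>; the description denotes such
  a set when \<open>p\<close> fits the box of \<open>code_ex1\<close>.\<close>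

definition decode :: "nat set \<Rightarrow> nat list \<Rightarrow> nat set" where
  "decode W p = (THE Z. Z \<subseteq> W \<and> code W Z = p)"

lemma decode:
  assumes "finite W" "length p \<le> card W" "fits (length p) (card W - length p) p"
  shows "decode W p \<subseteq> W" "code W (decode W p) = p"
  using theI'[OF code_ex1[OF assms]] by (simp_all add: decode_def)

text \<open>\<open>rebuild n lam L k i\<close> is the set \<open>level n lam F i (n - k)\<close> of the filling \<open>F\<close> sought.\<close>

primrec rebuild :: "nat \<Rightarrow> (nat \<Rightarrow> nat) \<Rightarrow> overlay \<Rightarrow> nat \<Rightarrow> nat \<Rightarrow> nat set" where
  "rebuild n lam L 0 i = {1..lam i}"
| "rebuild n lam L (Suc k) i = (if i \<le> n - Suc k
     then rebuild n lam L k i - decode (rebuild n lam L k i - rebuild n lam L k (Suc i)) (L (i, n - Suc k))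
     else {})"

text \<open>Collects what is needed about \<open>rebuild\<close>. Cardinalities are carried along
  with the inclusions, because decoding at level \<open>j\<close> is justified only if the set has
  the size prescribed by \<open>T\<close>.\<close>

lemma POP_levels:
  assumes part: "is_partition n lam" and POP: "(T, L) \<in> POP n lam"
  obtains S where
    "\<And>i. 1 \<le> i \<Longrightarrow> i \<le> n \<Longrightarrow> S i n = {1..lam i}"
    "\<And>i j. j \<le> n \<Longrightarrow> j < i \<Longrightarrow> i \<le> n \<Longrightarrow> S i j = {}"
    "\<And>i j. 1 \<le> i \<Longrightarrow> i \<le> j \<Longrightarrow> j \<le> n \<Longrightarrow> card (S i j) = T (i, j)"
    "\<And>i j. 1 \<le> i \<Longrightarrow> i \<le> j \<Longrightarrow> j < n \<Longrightarrow> S i j \<subseteq> S i (Suc j)"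
    "\<And>i j. 1 \<le> i \<Longrightarrow> i \<le> j \<Longrightarrow> j < n \<Longrightarrow> S (Suc i) (Suc j) \<subseteq> S i j"
    "\<And>i j. 1 \<le> i \<Longrightarrow> i \<le> j \<Longrightarrow> j < n \<Longrightarrow> code (S i (Suc j) - S (Suc i) (Suc j)) (S i (Suc j) - S i j) = L (i, j)"
proof -
  define S where "S i j = rebuild n lam L (n - j) i" for i j
  have S_n: "S i n = {1..lam i}" for i
    by (simp add: S_def)
  have S_j: "S i j = (if i \<le> j then S i (Suc j) - decode (S i (Suc j) - S (Suc i) (Suc j)) (L (i, j)) else {})"
    if "j < n" for i j
  proof -
    have "n - j = Suc (n - Suc j)" using that by simp
    then show ?thesis unfolding S_def using that by simp
  qed
  have T_n: "T (i, n) = lam i" if "1 \<le> i" "i \<le> n" for i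
    using POP that by (auto simp: POP_def GT_def)
  have T_j: "T (i, j) \<le> T (i, Suc j)" "T (Suc i, Suc j) \<le> T (i, j)" if "1 \<le> i" "i \<le> j" "j < n" for i j
    using POP that by (auto simp: POP_def GT_def)
  have L_fits: "fits (T (i, Suc j) - T (i, j)) (T (i, j) - T (Suc i, Suc j)) (L (i, j))"
    if "1 \<le> i" "i \<le> j" "j < n" for i j
    using POP that by (auto simp: POP_def overlay_idx_def NE_def SE_def)
  have fin: "finite (S i j)" if "j \<le> n" for i j
    using that
  proof (induction j arbitrary: i rule: inc_induct)
    case base
    show ?case by (simp add: S_n)
  next
    case (step j)
    then show ?case by (simp add: S_j)
  qed
  \<comment> \<open>The invariant at a single level: sizes as in \<open>T\<close>, and nested rows,
    so that the size of the next set to decode in is a difference of entries of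
    \<open>T\<close>.\<close>
  define inv where "inv j \<longleftrightarrow> (\<forall>i. 1 \<le> i \<longrightarrow> i \<le> j \<longrightarrow> card (S i j) = T (i, j)) \<and>
    (\<forall>i. 1 \<le> i \<longrightarrow> i < j \<longrightarrow> S (Suc i) j \<subseteq> S i j)" for j
  have descend: "inv j \<and> (\<forall>i. 1 \<le> i \<longrightarrow> i \<le> j \<longrightarrow> S i j \<subseteq> S i (Suc j) \<and> S (Suc i) (Suc j) \<subseteq> S i j \<and>
      code (S i (Suc j) - S (Suc i) (Suc j)) (S i (Suc j) - S i j) = L (i, j))"
    if inv: "inv (Suc j)" and "j < n" for j
  proof -
    have *: "card (S i j) = T (i, j) \<and> S i j \<subseteq> S i (Suc j) \<and> S (Suc i) (Suc j) \<subseteq> S i j \<and>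
      code (S i (Suc j) - S (Suc i) (Suc j)) (S i (Suc j) - S i j) = L (i, j)"
      if i: "1 \<le> i" "i \<le> j" for i
    proof -
      let ?A = "S i (Suc j)" and ?B = "S (Suc i) (Suc j)"
      let ?D = "decode (?A - ?B) (L (i, j))"
      have finA: "finite ?A" "finite ?B" using fin \<open>j < n\<close> by simp_all
      have BA: "?B \<subseteq> ?A" and cA: "card ?A = T (i, Suc j)" and cB: "card ?B = T (Suc i, Suc j)"
        using inv i by (simp_all add: inv_def)
      have cW: "card (?A - ?B) = T (i, Suc j) - T (Suc i, Suc j)"
        using BA finA cA cB by (simp add: card_Diff_subset)
      have len: "length (L (i, j)) = T (i, Suc j) - T (i, j)"
        using L_fits[OF i \<open>j < n\<close>] by (simp add: fits_def)
      note T = T_j[OF i \<open>j < n\<close>]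
      \<comment> \<open>The set has \<open>NE + SE\<close> elements and the list \<open>NE\<close>
        parts, so the width required by \<open>decode\<close> is the \<open>SE\<close> given by the
        overlay.\<close>
      have "T (i, Suc j) - T (Suc i, Suc j) - (T (i, Suc j) - T (i, j)) = T (i, j) - T (Suc i, Suc j)"
        using T by simp
      then have D: "?D \<subseteq> ?A - ?B" "code (?A - ?B) ?D = L (i, j)"
        using decode[of "?A - ?B" "L (i, j)"] L_fits[OF i \<open>j < n\<close>] finA T by (simp_all add: cW len)
      have "card ?D = length (L (i, j))"
        using length_code[of "?A - ?B" ?D] D(2) by simp
      moreover have Sij: "S i j = ?A - ?D"
        using i \<open>j < n\<close> by (simp add: S_j)
      moreover have "?D \<subseteq> ?A" using D(1) by blast
      ultimately have "card (S i j) = T (i, j)"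
        using finA T by (simp add: card_Diff_subset finite_subset cA len)
      moreover have "?A - S i j = ?D" using Sij \<open>?D \<subseteq> ?A\<close> by blast
      ultimately show ?thesis using D BA by (auto simp: Sij)
    qed
    \<comment> \<open>Nesting is restored through level \<open>j + 1\<close>:
      \<open>S (Suc i) j\<close> lies in \<open>S (Suc i) (Suc j)\<close>, which lies in
      \<open>S i j\<close>.\<close>
    have "S (Suc i) j \<subseteq> S i j" if i: "1 \<le> i" "i < j" for i
      using *[of i] *[of "Suc i"] i by auto
    then show ?thesis using * by (auto simp: inv_def)
  qed
  have inv: "inv j" if "j \<le> n" for j
    using that
  proof (induction j rule: inc_induct)
    case base
    show ?case using part by (auto simp: inv_def S_n T_n is_partition_def intro: le_trans)
  next
    case (step j)
    then show ?case using descend by blast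
  qed
  show ?thesis
  proof (rule that[of S])
    show "S i n = {1..lam i}" for i by (rule S_n)
    show "S i j = {}" if "j \<le> n" "j < i" "i \<le> n" for i j
      using that by (simp add: S_j)
    show "card (S i j) = T (i, j)" if "1 \<le> i" "i \<le> j" "j \<le> n" for i j
      using inv[of j] that by (simp add: inv_def)
    fix i j assume ij: "1 \<le> i" "i \<le> j" "j < n"
    then have "inv (Suc j)" using inv by simp
    then show "S i j \<subseteq> S i (Suc j)" "S (Suc i) (Suc j) \<subseteq> S i j"
      "code (S i (Suc j) - S (Suc i) (Suc j)) (S i (Suc j) - S i j) = L (i, j)"
      using descend[of j] ij by blast+
  qed
qed

text \<open>The entry of a cell is the first level at which its column appears in its row.
  \<open>top\<close> bounds it by \<open>n\<close>, \<open>empty\<close> bounds it below by the row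
  number, and \<open>interlace\<close> gives strict columns: a cell whose lower neighbour appears at
  \<open>v + 1\<close> has appeared by \<open>v\<close>.\<close>

lemma ex_CSF_level:
  assumes top: "\<And>i. 1 \<le> i \<Longrightarrow> i \<le> n \<Longrightarrow> S i n = {1..lam i}"
    and empty: "\<And>i j. j \<le> n \<Longrightarrow> j < i \<Longrightarrow> i \<le> n \<Longrightarrow> S i j = {}"
    and mono: "\<And>i j. 1 \<le> i \<Longrightarrow> i \<le> j \<Longrightarrow> j < n \<Longrightarrow> S i j \<subseteq> S i (Suc j)"
    and interlace: "\<And>i j. 1 \<le> i \<Longrightarrow> i \<le> j \<Longrightarrow> j < n \<Longrightarrow> S (Suc i) (Suc j) \<subseteq> S i j"
  shows "\<exists>F \<in> CSF n lam. \<forall>i j. 1 \<le> i \<and> i \<le> n \<and> j \<le> n \<longrightarrow> level n lam F i j = S i j"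
proof -
  define F where "F = restrict (\<lambda>(i, c). LEAST j. c \<in> S i j) (dg n lam)"
  have F_mem: "c \<in> S i (F (i, c))" and F_le: "c \<in> S i j \<Longrightarrow> F (i, c) \<le> j"
    and F_n: "F (i, c) \<le> n" and F_row: "i \<le> F (i, c)" if ic: "(i, c) \<in> dg n lam" for i c j
  proof -
    have eq: "F (i, c) = (LEAST j. c \<in> S i j)" using ic by (simp add: F_def)
    have n: "c \<in> S i n" using ic top by (simp add: dg_def)
    show mem: "c \<in> S i (F (i, c))" unfolding eq by (rule LeastI[of _ n]) (rule n)
    show le: "c \<in> S i j \<Longrightarrow> F (i, c) \<le> j" for j unfolding eq by (rule Least_le)
    show "F (i, c) \<le> n" using le n by blast
    then show "i \<le> F (i, c)" using mem empty[of "F (i, c)" i] ic by (fastforce simp: dg_def not_less)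
  qed
  have S_mono: "S i j \<subseteq> S i k" if "1 \<le> i" "i \<le> n" "j \<le> k" "k \<le> n" for i j k
    using that(3,4)
  proof (induction k rule: dec_induct)
    case (step k)
    \<comment> \<open>For \<open>k < i\<close> the hypothesis \<open>mono\<close> is silent, but
      there \<open>S i k\<close> is empty.\<close>
    have "S i k \<subseteq> S i (Suc k)"
      using mono[of i k] empty[of k i] step that(1,2) by (cases "i \<le> k") auto
    then show ?case using step by auto
  qed simp
  have lev: "level n lam F i j = S i j" if "1 \<le> i" "i \<le> n" "j \<le> n" for i j
  proof
    show "level n lam F i j \<subseteq> S i j"
      using F_mem S_mono[OF that(1,2) _ that(3)] by (fastforce simp: level_def)
    have "S i j \<subseteq> {1..lam i}" using S_mono[OF that order_refl] top that by simp
    then show "S i j \<subseteq> level n lam F i j"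
      using F_le that by (auto simp: level_def dg_def)
  qed
  have "F \<in> CSF n lam"
  proof -
    have "F \<in> dg n lam \<rightarrow>\<^sub>E {1..n}"
    proof (rule PiE_I)
      fix u assume u: "u \<in> dg n lam"
      then show "F u \<in> {1..n}"
        using F_n[of "fst u" "snd u"] F_row[of "fst u" "snd u"] by (auto simp: dg_def)
    qed (simp add: F_def)
    moreover have "F (i, c) < F (Suc i, c)" if c: "(i, c) \<in> dg n lam" "(Suc i, c) \<in> dg n lam" for i c
    proof -
      obtain v where v: "F (Suc i, c) = Suc v" using F_row[OF c(2)] by (cases "F (Suc i, c)") auto
      then have "c \<in> S (Suc i) (Suc v)" "v < n" "i \<le> v" "1 \<le> i"
        using F_mem[OF c(2)] F_n[OF c(2)] F_row[OF c(2)] c(1) by (auto simp: dg_def)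
      then have "F (i, c) \<le> v"
        using interlace F_le[OF c(1)] by blast
      then show ?thesis using v by simp
    qed
    ultimately show ?thesis by (auto simp: CSF_def below_def)
  qed
  then show ?thesis using lev by blast
qed

lemma psi_inv_surj:
  assumes part: "is_partition n lam" and POP: "(T, L) \<in> POP n lam"
  shows "(T, L) \<in> psi_inv n lam ` CSF n lam"
proof (rule POP_levels[OF assms])
  fix S :: "nat \<Rightarrow> nat \<Rightarrow> nat set" assume S:
    "\<And>i. 1 \<le> i \<Longrightarrow> i \<le> n \<Longrightarrow> S i n = {1..lam i}"
    "\<And>i j. j \<le> n \<Longrightarrow> j < i \<Longrightarrow> i \<le> n \<Longrightarrow> S i j = {}"
    "\<And>i j. 1 \<le> i \<Longrightarrow> i \<le> j \<Longrightarrow> j \<le> n \<Longrightarrow> card (S i j) = T (i, j)"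
    "\<And>i j. 1 \<le> i \<Longrightarrow> i \<le> j \<Longrightarrow> j < n \<Longrightarrow> S i j \<subseteq> S i (Suc j)"
    "\<And>i j. 1 \<le> i \<Longrightarrow> i \<le> j \<Longrightarrow> j < n \<Longrightarrow> S (Suc i) (Suc j) \<subseteq> S i j"
    "\<And>i j. 1 \<le> i \<Longrightarrow> i \<le> j \<Longrightarrow> j < n \<Longrightarrow> code (S i (Suc j) - S (Suc i) (Suc j)) (S i (Suc j) - S i j) = L (i, j)"
  obtain F where F: "F \<in> CSF n lam"
    and lev: "\<And>i j. 1 \<le> i \<Longrightarrow> i \<le> n \<Longrightarrow> j \<le> n \<Longrightarrow> level n lam F i j = S i j"
    using ex_CSF_level[of n S lam, OF S(1,2,4,5)] by blast
  have "T = pattern_of n lam (rsort n lam F)"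
  proof (rule extensionalityI)
    show "T \<in> extensional {(i, j). 1 \<le> i \<and> i \<le> j \<and> j \<le> n}"
      using POP by (simp add: POP_def GT_def)
    show "pattern_of n lam (rsort n lam F) \<in> extensional {(i, j). 1 \<le> i \<and> i \<le> j \<and> j \<le> n}"
      by (simp add: pattern_of_def)
    fix x :: "nat \<times> nat" assume "x \<in> {(i, j). 1 \<le> i \<and> i \<le> j \<and> j \<le> n}"
    then obtain i j where x: "x = (i, j)" and ij: "1 \<le> i" "i \<le> j" "j \<le> n" by auto
    then show "T x = pattern_of n lam (rsort n lam F) x"
      using lev[of i j] S(3)[OF ij] pattern_of_rsort[OF ij] by simp
  qed
  moreover have "L = restrict (\<lambda>(i, j). map (refzcount n lam F) (cells_ltr n lam i j F)) (overlay_idx n)"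
  proof (rule extensionalityI)
    show "L \<in> extensional (overlay_idx n)"
      using POP by (simp add: POP_def)
    fix x assume x: "x \<in> overlay_idx n"
    then obtain i j where "x = (i, j)" and ij: "1 \<le> i" "i \<le> j" "j < n"
      by (auto simp: overlay_idx_def)
    then show "L x = restrict (\<lambda>(i, j). map (refzcount n lam F) (cells_ltr n lam i j F)) (overlay_idx n) x"
      using x overlay_code[OF part F ij(1), of j] lev[of i j] lev[of i "Suc j"] lev[of "Suc i" "Suc j"] S(6)[OF ij]
      by simp
  qed simp
  ultimately have "psi_inv n lam F = (T, L)"
    by (simp add: psi_inv_def)
  then show ?thesis
    using imageI[OF F, of "psi_inv n lam"] by simp
qed

section \<open>Bijectivity of \<open>psi_inv\<close>\<close>

lemma bij_psi_inv:
  assumes "is_partition n lam"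
  shows "bij_betw (psi_inv n lam) (CSF n lam) (POP n lam)"
proof (rule bij_betw_imageI[OF psi_inv_inj[OF assms]], rule subset_antisym)
  show "psi_inv n lam ` CSF n lam \<subseteq> POP n lam"
    using psi_inv_POP[OF assms] by (rule image_subsetI)
  show "POP n lam \<subseteq> psi_inv n lam ` CSF n lam"
    using psi_inv_surj[OF assms] by (rule subrelI)
qed

section \<open>Complementation\<close>

lemma fits_complement: "fits k l p \<Longrightarrow> fits k l (complement l p)"
proof -
  assume p: "fits k l p"
  then have "sorted_wrt (\<ge>) p" by (simp add: fits_def)
  then have "sorted_wrt (\<lambda>x y. l - x \<le> l - y) p"
    by (rule sorted_wrt_mono_rel[rotated]) (simp add: diff_le_mono2)
  then show ?thesis
    using p by (auto simp: fits_def complement_def sorted_wrt_map sorted_wrt_rev)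
qed

lemma complement_complement: "fits k l p \<Longrightarrow> complement l (complement l p) = p"
  by (simp add: fits_def complement_def rev_map o_def map_idI)

lemma bcomp_POP: "P \<in> POP n lam \<Longrightarrow> bcomp n P \<in> POP n lam"
  by (cases P) (force simp: POP_def bcomp_def intro: fits_complement)

lemma bcomp_bcomp:
  assumes "P \<in> POP n lam"
  shows "bcomp n (bcomp n P) = P"
proof -
  obtain T L where P: "P = (T, L)" by (cases P)
  have "restrict (\<lambda>(i, j). complement (SE T i j)
      (restrict (\<lambda>(i, j). complement (SE T i j) (L (i, j))) (overlay_idx n) (i, j))) (overlay_idx n) = L"
  proof (rule extensionalityI)
    show "L \<in> extensional (overlay_idx n)" using assms by (simp add: P POP_def)
    fix x assume x: "x \<in> overlay_idx n"
    obtain i j where ij: "x = (i, j)" by (cases x)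
    have "fits (NE T i j) (SE T i j) (L (i, j))"
      using assms x by (auto simp: P POP_def ij)
    then show "restrict (\<lambda>(i, j). complement (SE T i j)
      (restrict (\<lambda>(i, j). complement (SE T i j) (L (i, j))) (overlay_idx n) (i, j))) (overlay_idx n) x = L x"
      using x by (simp add: ij complement_complement)
  qed simp
  then show ?thesis by (simp add: P bcomp_def)
qed

lemma bij_bcomp: "bij_betw (bcomp n) (POP n lam) (POP n lam)"
  by (rule bij_betw_byWitness[of _ "bcomp n"]) (auto simp: bcomp_POP bcomp_bcomp)

text \<open>Both counts range over the same set of \<open>SE\<close> columns, one to the left and
  one to the right of \<open>z\<close>. Column \<open>z\<close> itself is not in this set, since its
  entry \<open>j + 1\<close> exceeds \<open>j\<close>.\<close>

lemma zcount_complement: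
  assumes part: "is_partition n lam" and F: "F \<in> CSF n lam"
    and ij: "(i, j) \<in> overlay_idx n" and u: "u \<in> cells n lam i j F"
  shows "zcount n lam F u = SE (pattern_of n lam (rsort n lam F)) i j - refzcount n lam F u"
proof -
  obtain z where z: "u = (i, z)" "(i, z) \<in> dg n lam" "F (i, z) = Suc j"
    using u by (cases u) (auto simp: cells_def)
  let ?O = "level n lam F i j - level n lam F (Suc i) (Suc j)"
  have "zcount n lam F u = card {d \<in> ?O. d < z}" "refzcount n lam F u = card {d \<in> ?O. z < d}"
    unfolding z(1) zcount_eq[OF z(2)] refzcount_eq[OF z(2)] z(3)
    by (rule arg_cong[of _ _ card]; auto simp: level_def)+
  moreover have "card ?O = card {d \<in> ?O. d < z} + card {d \<in> ?O. z < d}"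
  proof -
    have "z \<notin> ?O" using z by (simp add: level_def)
    then have "{d \<in> ?O. d < z} \<union> {d \<in> ?O. z < d} = ?O"
      by (auto simp: not_less le_less)
    moreover have "card ({d \<in> ?O. d < z} \<union> {d \<in> ?O. z < d}) = card {d \<in> ?O. d < z} + card {d \<in> ?O. z < d}"
      by (rule card_Un_disjoint) auto
    ultimately show ?thesis by argo
  qed
  ultimately show ?thesis
    using ij by (simp add: SE_pattern[OF part F] overlay_idx_def)
qed

text \<open>The opposite directions of traversal in the two maps account for the reversal inside
  \<open>complement\<close>.\<close>

lemma psi_quinv_bcomp:
  assumes "is_partition n lam" "F \<in> CSF n lam"
  shows "psi_quinv n lam F = bcomp n (psi_inv n lam F)"
  using zcount_complement[OF assms]
  by (auto simp: psi_quinv_def psi_inv_def bcomp_def complement_def rev_map intro!: restrict_ext)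

section \<open>The statistics\<close>

lemma card_fibres:
  assumes "finite A" "f ` A \<subseteq> B" "finite B"
  shows "card A = (\<Sum>b\<in>B. card {a \<in> A. f a = b})"
  using sum.group[OF assms(1,3,2), of "\<lambda>_. 1::nat"] by simp

lemma finite_quinv_triples: "finite (quinv_triples n lam F)"
proof (rule finite_subset)
  show "quinv_triples n lam F \<subseteq> dg n lam \<times> below ` dg n lam \<times> dg n lam"
    by (auto simp: quinv_triples_def)
qed simp

lemma finite_refinv_triples: "finite (refinv_triples n lam F)"
proof (rule finite_subset)
  show "refinv_triples n lam F \<subseteq> dg n lam \<times> below ` dg n lam \<times> dg n lam"
    by (auto simp: refinv_triples_def)
qed simp

lemma quinv_sum: "quinv n lam F = (\<Sum>c \<in> dg n lam. zcount n lam F c)"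
proof -
  have "quinv n lam F = (\<Sum>c \<in> dg n lam. card {t \<in> quinv_triples n lam F. snd (snd t) = c})"
    unfolding quinv_def by (rule card_fibres) (auto simp: finite_quinv_triples, auto simp: quinv_triples_def)
  moreover have "{t \<in> quinv_triples n lam F. snd (snd t) = c} = {(x, y, z) \<in> quinv_triples n lam F. z = c}" for c
    by auto
  ultimately show ?thesis by (simp only: zcount_def)
qed

lemma refinv_sum: "card (refinv_triples n lam F) = (\<Sum>c \<in> dg n lam. refzcount n lam F c)"
proof -
  have "card (refinv_triples n lam F) = (\<Sum>c \<in> dg n lam. card {t \<in> refinv_triples n lam F. snd (snd t) = c})"
    by (rule card_fibres) (auto simp: finite_refinv_triples, auto simp: refinv_triples_def)
  moreover have "{t \<in> refinv_triples n lam F. snd (snd t) = c} = {(x, y, z) \<in> refinv_triples n lam F. z = c}" for c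
    by auto
  ultimately show ?thesis by (simp only: refzcount_def)
qed

text \<open>The overlay components see only entries \<open>j + 1\<close> with \<open>j\<close> at
  least the row number. The remaining cells carry the least entry possible in their row, which is
  why \<open>f\<close> has to vanish there.\<close>

lemma sum_overlay:
  assumes part: "is_partition n lam" and F: "F \<in> CSF n lam"
    and zero: "\<And>c. c \<in> dg n lam \<Longrightarrow> F c = fst c \<Longrightarrow> f c = (0::nat)"
  shows "(\<Sum>c \<in> dg n lam. f c) = (\<Sum>p \<in> overlay_idx n. \<Sum>c \<in> cells n lam (fst p) (snd p) F. f c)"
proof -
  have fin: "finite (overlay_idx n)"
    by (rule finite_subset[of _ "{..n} \<times> {..n}"]) (auto simp: overlay_idx_def)
  have finc: "finite (cells n lam i j F)" for i j
    by (simp add: cells_def)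
  have "(\<Sum>p \<in> overlay_idx n. \<Sum>c \<in> cells n lam (fst p) (snd p) F. f c)
      = (\<Sum>c \<in> (\<Union>p \<in> overlay_idx n. cells n lam (fst p) (snd p) F). f c)"
    by (rule sum.UNION_disjoint[symmetric]) (auto simp: fin finc, auto simp: cells_def)
  also have "\<dots> = (\<Sum>c \<in> dg n lam. f c)"
  proof (rule sum.mono_neutral_left)
    show "(\<Union>p \<in> overlay_idx n. cells n lam (fst p) (snd p) F) \<subseteq> dg n lam"
      by (auto simp: cells_def)
    show "\<forall>c \<in> dg n lam - (\<Union>p \<in> overlay_idx n. cells n lam (fst p) (snd p) F). f c = 0"
    proof
      fix c assume c: "c \<in> dg n lam - (\<Union>p \<in> overlay_idx n. cells n lam (fst p) (snd p) F)"
      then have "F c \<le> n" "fst c \<le> F c" "1 \<le> fst c"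
        using CSF_range(2)[OF F, of c] CSF_ge_row[OF part F, of "fst c" "snd c"] by (auto simp: dg_def)
      moreover have "fst c \<ge> F c"
      proof (rule ccontr)
        assume "\<not> fst c \<ge> F c"
        then have "(fst c, F c - 1) \<in> overlay_idx n" "c \<in> cells n lam (fst c) (F c - 1) F"
          using calculation c by (auto simp: overlay_idx_def cells_def)
        then show False using c by force
      qed
      ultimately show "f c = 0" using zero c by simp
    qed
  qed simp
  finally show ?thesis by simp
qed

text \<open>Together with \<open>refinv_psi\<close> this expresses both triple counts by the same
  function of the overlay, so equal images give equal counts.\<close>

lemma quinv_psi:
  assumes part: "is_partition n lam" and F: "F \<in> CSF n lam"
  shows "quinv n lam F = (\<Sum>p \<in> overlay_idx n. sum_list (snd (psi_quinv n lam F) p))"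
proof -
  have "zcount n lam F c = 0" if "c \<in> dg n lam" "F c = fst c" for c
  proof -
    obtain i z where c: "c = (i, z)" by (cases c)
    \<comment> \<open>Here \<open>F (i, z) = i\<close>, and no entry of row \<open>i\<close> is
      smaller than \<open>i\<close>.\<close>
    have "{d. (i, d) \<in> dg n lam \<and> d < z \<and> F (i, d) < F (i, z) \<and> d \<notin> level n lam F (Suc i) (F (i, z))} = {}"
      using CSF_ge_row[OF part F] that by (fastforce simp: c)
    then show ?thesis using that by (simp only: c zcount_eq) simp
  qed
  then have "quinv n lam F = (\<Sum>p \<in> overlay_idx n. \<Sum>c \<in> cells n lam (fst p) (snd p) F. zcount n lam F c)"
    unfolding quinv_sum by (rule sum_overlay[OF part F])
  also have "\<dots> = (\<Sum>p \<in> overlay_idx n. sum_list (snd (psi_quinv n lam F) p))"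
    by (rule sum.cong) (auto simp: psi_quinv_def sum_list_distinct_conv_sum_set split: prod.splits)
  finally show ?thesis .
qed

lemma refinv_psi:
  assumes part: "is_partition n lam" and F: "F \<in> CSF n lam"
  shows "card (refinv_triples n lam F) = (\<Sum>p \<in> overlay_idx n. sum_list (snd (psi_inv n lam F) p))"
proof -
  have "refzcount n lam F c = 0" if "c \<in> dg n lam" "F c = fst c" for c
  proof -
    obtain i z where c: "c = (i, z)" by (cases c)
    have "{d. (i, d) \<in> dg n lam \<and> z < d \<and> F (i, d) < F (i, z) \<and> d \<notin> level n lam F (Suc i) (F (i, z))} = {}"
      using CSF_ge_row[OF part F] that by (fastforce simp: c)
    then show ?thesis using that by (simp only: c refzcount_eq) simp
  qed
  then have "card (refinv_triples n lam F)
      = (\<Sum>p \<in> overlay_idx n. \<Sum>c \<in> cells n lam (fst p) (snd p) F. refzcount n lam F c)"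
    unfolding refinv_sum by (rule sum_overlay[OF part F])
  also have "\<dots> = (\<Sum>p \<in> overlay_idx n. sum_list (snd (psi_inv n lam F) p))"
    by (rule sum.cong) (auto simp: psi_inv_def sum_list_distinct_conv_sum_set split: prod.splits)
  finally show ?thesis .
qed

text \<open>\<open>P\<close> holds the inversions within a row and \<open>Q\<close> all attacking
  pairs in consecutive rows, split into inversions \<open>Q1\<close> and the rest \<open>Q2\<close>.
  The arms sum to \<open>card Q\<close>, so \<open>inv_stat\<close> is
  \<open>card P - card Q2\<close>. \<open>Q2\<close> matches the subset \<open>P'\<close> of
  \<open>P\<close>, and \<open>P - P'\<close> matches the refinv-triples.\<close>

lemma inv_stat_refinv:
  assumes part: "is_partition n lam" and F: "F \<in> CSF n lam"
  shows "inv_stat n lam F = int (card (refinv_triples n lam F))"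
proof -
  let ?D = "dg n lam"
  define P where "P = {(u, w). u \<in> ?D \<and> w \<in> ?D \<and> fst u = fst w \<and> snd u < snd w \<and> F w < F u}"
  define P' where "P' = {(u, w) \<in> P. below w \<in> ?D \<and> F (below w) \<le> F u}"
  define Q where "Q = {(u, w). u \<in> ?D \<and> w \<in> ?D \<and> fst u = Suc (fst w) \<and> snd w < snd u}"
  define Q1 where "Q1 = {(u, w) \<in> Q. F w < F u}"
  define Q2 where "Q2 = {(u, w) \<in> Q. F u \<le> F w}"
  have "P \<subseteq> ?D \<times> ?D" "Q \<subseteq> ?D \<times> ?D"
    by (auto simp: P_def Q_def)
  then have finPQ: "finite P" "finite Q"
    using finite_subset[of _ "?D \<times> ?D"] by simp_all
  moreover have "P' \<subseteq> P" "Q1 \<subseteq> Q" "Q2 \<subseteq> Q"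
    by (auto simp: P'_def Q1_def Q2_def)
  ultimately have fin: "finite P'" "finite Q1" "finite Q2"
    using finite_subset by blast+

  have "Inv_pairs n lam F = P \<union> Q1"
    by (auto simp: Inv_pairs_def P_def Q1_def Q_def attack_def precedes_def)
  moreover have "P \<inter> Q1 = {}"
    by (auto simp: P_def Q1_def Q_def)
  ultimately have inv_pairs: "card (Inv_pairs n lam F) = card P + card Q1"
    using finPQ fin by (simp add: card_Un_disjoint)

  have "Q = Q1 \<union> Q2" "Q1 \<inter> Q2 = {}"
    by (auto simp: Q1_def Q2_def)
  then have cardQ: "card Q = card Q1 + card Q2"
    using fin by (simp add: card_Un_disjoint)

  have "F (fst u - 1, snd u) < F u" if "u \<in> ?D" "1 < fst u" for u
    using CSF_less[OF part F, of "fst u - 1" "snd u"] that by simp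
  then have Des: "Des n lam F = {u \<in> ?D. 1 < fst u}"
    by (auto simp: Des_def)
  have "(\<Sum>u \<in> Des n lam F. arm n lam u)
      = card (SIGMA u:Des n lam F. {w \<in> ?D. fst w = fst u \<and> snd u < snd w})"
    by (simp add: arm_def Des)
  also have "\<dots> = card Q"
  proof (rule bij_betw_same_card, rule bij_betw_byWitness)
    \<comment> \<open>A cell \<open>w\<close> in the arm of \<open>u\<close> attacks the cell above
      \<open>u\<close>; every pair in \<open>Q\<close> arises once in this way.\<close>
    let ?f = "\<lambda>(u :: cell, w :: cell). (w, (fst u - 1, snd u))"
    let ?g = "\<lambda>(u :: cell, w :: cell). ((fst u, snd w), u)"
    show "?f ` (SIGMA u:Des n lam F. {w \<in> ?D. fst w = fst u \<and> snd u < snd w}) \<subseteq> Q"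
    proof -
      have "(r - 1, c) \<in> ?D" if "(r, c) \<in> ?D" "1 < r" for r c
        using dg_up[OF part, of "r - 1" c] that by simp
      then show ?thesis by (auto simp: Des Q_def)
    qed
    show "?g ` Q \<subseteq> (SIGMA u:Des n lam F. {w \<in> ?D. fst w = fst u \<and> snd u < snd w})"
      by (auto simp: Des Q_def dg_def)
  qed (auto simp: Q_def Des)
  finally have arms: "(\<Sum>u \<in> Des n lam F. arm n lam u) = card Q" .

  have "card P' = card Q2"
  proof (rule bij_betw_same_card, rule bij_betw_byWitness)
    let ?f = "\<lambda>(u :: cell, w :: cell). (below w, u)"
    let ?g = "\<lambda>(u :: cell, w :: cell). (w, (fst u - 1, snd u))"
    show "?f ` P' \<subseteq> Q2"
      by (auto simp: P'_def P_def Q2_def Q_def below_def)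
    show "?g ` Q2 \<subseteq> P'"
    proof -
      \<comment> \<open>For \<open>(u, w)\<close> in \<open>Q2\<close>, the cell above
        \<open>u\<close> has an entry smaller than \<open>F u\<close>, hence smaller than
        \<open>F w\<close>; so it forms an inversion with \<open>w\<close> in their common
        row.\<close>
      have "(i, d) \<in> ?D \<and> F (i, d) < F (i, c)"
        if "(Suc i, d) \<in> ?D" "(i, c) \<in> ?D" "F (Suc i, d) \<le> F (i, c)" for i c d
        using dg_up[OF part that(1)] CSF_less[OF part F that(1)] that by (force simp: dg_def)
      then show ?thesis
        by (auto simp: P'_def P_def Q2_def Q_def below_def)
    qed
  qed (auto simp: P'_def P_def Q2_def Q_def below_def)
  moreover have "card (refinv_triples n lam F) = card (P - P')"
  proof -
    \<comment> \<open>In an inversion \<open>(z, x)\<close> outside \<open>P'\<close>, the cell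
      below \<open>x\<close> is missing or exceeds \<open>F z\<close>, which is the remaining
      condition on a triple.\<close>
    have "t \<in> refinv_triples n lam F \<longleftrightarrow> (\<exists>z x. t = (x, below x, z) \<and> (z, x) \<in> P - P')" for t
      by (cases t) (auto simp: refinv_triples_def P_def P'_def entry_def)
    then have "refinv_triples n lam F = (\<lambda>(z, x). (x, below x, z)) ` (P - P')"
      by (simp only: set_eq_iff image_iff Bex_def split_paired_Ex prod.case) blast
    then show ?thesis by (simp add: card_image inj_on_def split: prod.splits)
  qed
  moreover have "P' \<subseteq> P" by (auto simp: P'_def)
  ultimately have "card P = card (refinv_triples n lam F) + card Q2"
    using finPQ(1) fin(1) card_mono[OF finPQ(1) \<open>P' \<subseteq> P\<close>] by (simp add: card_Diff_subset)
  then show ?thesis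
    using arms cardQ inv_pairs by (simp add: inv_stat_def flip: of_nat_sum)
qed

text \<open>The two bijections belong to the conclusion because they make \<open>inv_into\<close> in
  \<open>Omega\<close> a genuine inverse at every value of \<open>psi_quinv\<close>.\<close>

theorem corollary2:
  fixes n :: nat and lam :: "nat \<Rightarrow> nat"
  assumes "n \<ge> 1" and "is_partition n lam"
  shows "bij_betw (psi_quinv n lam) (CSF n lam) (POP n lam) \<and>
    bij_betw (psi_inv n lam) (CSF n lam) (POP n lam) \<and>
    (\<forall>F \<in> CSF n lam. Omega n lam F =
       inv_into (CSF n lam) (psi_inv n lam) (bcomp n (psi_inv n lam F))) \<and>
    (\<forall>F \<in> CSF n lam. Omega n lam F \<in> CSF n lam \<and> Omega n lam (Omega n lam F) = F) \<and>
    (\<forall>F \<in> CSF n lam. inv_stat n lam (Omega n lam F) = int (quinv n lam F))"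
proof (intro conjI ballI)
  note part = assms(2)
  let ?C = "CSF n lam" and ?psi = "psi_inv n lam" and ?O = "Omega n lam"
  note bij = bij_psi_inv[OF part]
  show "bij_betw ?psi ?C (POP n lam)" by (rule bij)
  have "bij_betw (bcomp n \<circ> ?psi) ?C (POP n lam)"
    using bij bij_bcomp by (rule bij_betw_trans)
  then show bijq: "bij_betw (psi_quinv n lam) ?C (POP n lam)"
    by (rule bij_betw_cong[THEN iffD1, rotated]) (simp add: psi_quinv_bcomp part)
  fix F assume F: "F \<in> ?C"
  have psiO: "?psi (?O G) = psi_quinv n lam G" if "G \<in> ?C" for G
    unfolding Omega_def using bij bijq that by (metis bij_betw_inv_into_right bij_betwE)
  have OC: "?O G \<in> ?C" if "G \<in> ?C" for G
    unfolding Omega_def using bij bijq that by (metis bij_betw_def bij_betwE inv_into_into)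
  show "?O F = inv_into ?C ?psi (bcomp n (?psi F))"
    using F by (simp add: Omega_def psi_quinv_bcomp part)
  show "?O F \<in> ?C" by (rule OC[OF F])
  \<comment> \<open>Under \<open>psi_inv\<close> the map \<open>Omega\<close> becomes
    \<open>bcomp\<close>, which is an involution on \<open>POP\<close>.\<close>
  have "?psi (?O (?O F)) = ?psi F"
    using F by (simp add: psiO OC psi_quinv_bcomp[OF part] bcomp_bcomp[OF psi_inv_POP[OF part]])
  then show "?O (?O F) = F"
    using bij OC F by (metis bij_betw_def inj_onD)
  \<comment> \<open>Both sides are the total size of one overlay, as \<open>psi_inv\<close> at
    \<open>Omega F\<close> equals \<open>psi_quinv\<close> at \<open>F\<close>.\<close>
  show "inv_stat n lam (?O F) = int (quinv n lam F)"
    using inv_stat_refinv[OF part OC[OF F]] refinv_psi[OF part OC[OF F]] quinv_psi[OF part F] psiO[OF F]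
    by simp
qed

end
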